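(* Let $H$ be a finite-dimensional quasitriangular bialgebra with universal R-matrix $\mathcal{R}$ and involution $\tau$, let $A$ be an associative algebra, and let $S_A\in H\otimes A$ be a universal S-matrix over $H$ with coefficients in $A$. Then $S_A$ defines a ring homomorphism (multiplicative linear map) $\phi\colon H^\circledast\to A$ such that $S_A=(\mathrm{id}\otimes\phi)(S)$, where $S$ is the canonical element of $H\otimes H^\circledast$.
   Context: All algebras are over $\mathbb{C}$; summation over tensor components is suppressed. A universal R-matrix is an invertible $\mathcal{R}=\mathcal{R}_1\otimes\mathcal{R}_2\in H\otimes H$ with $(\Delta\otimes\mathrm{id})(\mathcal{R})=\mathcal{R}_{13}\mathcal{R}_{23}$, $(\mathrm{id}\otimes\Delta)(\mathcal{R})=\mathcal{R}_{13}\mathcal{R}_{12}$ and $\mathcal{R}\Delta(h)=\Delta_{op}(h)\mathcal{R}$ for all $h\in H$. An involution $\tau\colon H\to H$ is a linear map with $\tau^2=\mathrm{id}$ that is a coalgebra map and an algebra anti-automorphism. Put $\mathcal{R}'=\tau(\mathcal{R}_1)\otimes\mathcal{R}_2$. A universal S-matrix over $H$ with coefficients in $A$ is a non-zero element $S_A=\sum_i s_i\otimes a_i\in H\otimes A$ such that $(\Delta\otimes\mathrm{id})(S_A)=(S_A)_1\mathcal{R}'_{12}(S_A)_2$ in $H\otimes H\otimes A$ (subscripts mark the $H$-factors), i.e. $\sum_i\Delta(s_i)\otimes a_i=\sum_{i,j}s_i\tau(\mathcal{R}_1)\otimes\mathcal{R}_2s_j\otimes a_ia_j$. $H^*$ is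 the dual algebra (product $m$ dual to $\Delta$), an $H$-bimodule by $\langle h\triangleright a,x\rangle=\langle a,xh\rangle$, $\langle a\triangleleft h,x\rangle=\langle a,hx\rangle$. The RE dual $H^\circledast$ is the vector space $H^*$ with the associative product $\tilde m(a\otimes b)=m\bigl(\tau(\bar{\mathcal{R}}_1)\triangleright a\otimes b\triangleleft\bar{\mathcal{R}}_2\bigr)$, $\bar{\mathcal R}=\mathcal{R}^{-1}$. The canonical element is $S=\sum_\mu e_\mu\otimes e^\mu$ with $\{e_\mu\}$ a basis of $H$ and $\{e^\mu\}$ the dual basis of $H^*=H^\circledast$. *)

theory Defs
  imports Complex_Main "HOL-Library.Poly_Mapping"
begin

class complex_vector = ab_group_add +
  fixes scaleC :: "complex \<Rightarrow> 'a \<Rightarrow> 'a" (infixr "*\<^sub>C" 75)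
  assumes scaleC_add_right: "c *\<^sub>C (x + y) = c *\<^sub>C x + c *\<^sub>C y"
    and scaleC_add_left: "(c + d) *\<^sub>C x = c *\<^sub>C x + d *\<^sub>C x"
    and scaleC_scaleC: "c *\<^sub>C d *\<^sub>C x = (c * d) *\<^sub>C x"
    and scaleC_one: "1 *\<^sub>C x = x"

global_interpretation cvec: vector_space "scaleC :: complex \<Rightarrow> 'a \<Rightarrow> 'a::complex_vector"
  by unfold_locales (fact scaleC_add_right scaleC_add_left scaleC_scaleC scaleC_one)+

global_interpretation cvec_pair: vector_space_pair
  "scaleC :: complex \<Rightarrow> 'a \<Rightarrow> 'a::complex_vector"
  "scaleC :: complex \<Rightarrow> 'b \<Rightarrow> 'b::complex_vector"
  by unfold_locales

abbreviation clinear :: "('a::complex_vector \<Rightarrow> 'b::complex_vector) \<Rightarrow> bool"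
  where "clinear \<equiv> Vector_Spaces.linear scaleC scaleC"

definition cbilinear :: "('a::complex_vector \<Rightarrow> 'b::complex_vector \<Rightarrow> 'c::complex_vector) \<Rightarrow> bool"
  where "cbilinear f \<longleftrightarrow> (\<forall>x. clinear (f x)) \<and> (\<forall>y. clinear (\<lambda>x. f x y))"

definition cbasis :: "'a::complex_vector set \<Rightarrow> bool"
  where "cbasis B \<longleftrightarrow> \<not> cvec.dependent B \<and> cvec.span B = UNIV"

text \<open>Algebras are associative; a unit is required only in the second class.  There is no
  axiom \<open>0 \<noteq> 1\<close>, so that the tensor product of unital algebras is trivially an instance.\<close>

class complex_algebra = complex_vector + ring +
  assumes mult_scaleC_left: "(c *\<^sub>C x) * y = c *\<^sub>C (x * y)"
    and mult_scaleC_right: "x * (c *\<^sub>C y) = c *\<^sub>C (x * y)"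

class complex_unital_algebra = complex_algebra + monoid_mult

definition cinvertible :: "'a::monoid_mult \<Rightarrow> bool"
  where "cinvertible x \<longleftrightarrow> (\<exists>y. x * y = 1 \<and> y * x = 1)"

definition cinverse :: "'a::monoid_mult \<Rightarrow> 'a"
  where "cinverse x = (THE y. x * y = 1 \<and> y * x = 1)"

instantiation complex :: complex_unital_algebra
begin
definition "scaleC_complex = ((*) :: complex \<Rightarrow> complex \<Rightarrow> complex)"
instance by standard (auto simp: scaleC_complex_def algebra_simps)
end

lemma scaleC_complex [simp]: "c *\<^sub>C z = c * z" for c z :: complex
  by (simp add: scaleC_complex_def)

lemma clinearI:
  assumes "\<And>x y. f (x + y) = f x + f y" "\<And>c x. f (c *\<^sub>C x) = c *\<^sub>C f x"
  shows "clinear f"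
  using assms by unfold_locales auto

lemma clinear_add: "clinear f \<Longrightarrow> f (x + y) = f x + f y"
  by (rule cvec_pair.linear_add)

lemma clinear_scaleC: "clinear f \<Longrightarrow> f (c *\<^sub>C x) = c *\<^sub>C f x"
  by (rule cvec_pair.linear_scale)

lemma cbilinearI:
  assumes "\<And>x y y'. f x (y + y') = f x y + f x y'" "\<And>c x y. f x (c *\<^sub>C y) = c *\<^sub>C f x y"
    and "\<And>x x' y. f (x + x') y = f x y + f x' y" "\<And>c x y. f (c *\<^sub>C x) y = c *\<^sub>C f x y"
  shows "cbilinear f"
  unfolding cbilinear_def using assms by (auto intro!: clinearI)

lemma cbilinearD:
  assumes "cbilinear f"
  shows "f x (y + y') = f x y + f x y'" "f x (c *\<^sub>C y) = c *\<^sub>C f x y"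
    and "f (x + x') y = f x y + f x' y" "f (c *\<^sub>C x) y = c *\<^sub>C f x y"
  using assms clinear_add[of "f x"] clinear_scaleC[of "f x"]
    clinear_add[of "\<lambda>x. f x y"] clinear_scaleC[of "\<lambda>x. f x y"]
  unfolding cbilinear_def by auto

lemma cinverse_eqI:
  fixes x :: "'a::monoid_mult"
  assumes "x * y = 1" "y * x = 1"
  shows "cinverse x = y"
  unfolding cinverse_def using assms
  by (intro the_equality) (auto, metis mult.assoc mult_1_left mult_1_right)

lemma cinverse:
  fixes x :: "'a::monoid_mult"
  assumes "cinvertible x"
  shows "x * cinverse x = 1" "cinverse x * x = 1"
  using assms cinverse_eqI unfolding cinvertible_def by metis+

instantiation poly_mapping :: (type, complex_vector) complex_vector
begin

definition scaleC_poly_mapping :: "complex \<Rightarrow> ('a \<Rightarrow>\<^sub>0 'b) \<Rightarrow> 'a \<Rightarrow>\<^sub>0 'b"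
  where "scaleC_poly_mapping c p = Poly_Mapping.map (scaleC c) p"

lemma lookup_scaleC: "poly_mapping.lookup (c *\<^sub>C p) k = c *\<^sub>C poly_mapping.lookup p k"
  by (simp add: scaleC_poly_mapping_def Poly_Mapping.map.rep_eq when_def)

instance
  by standard (auto intro!: poly_mapping_eqI
      simp: lookup_scaleC lookup_add scaleC_add_left scaleC_add_right scaleC_scaleC scaleC_one)

end

text \<open>The tensor product is the free vector space on \<open>'a \<times> 'b\<close> modulo the span of the
  bilinearity relations.\<close>

definition tensor_relations :: "('a::complex_vector \<times> 'b::complex_vector \<Rightarrow>\<^sub>0 complex) set"
  where "tensor_relations =
     {Poly_Mapping.single (x + x', y) 1 - Poly_Mapping.single (x, y) 1
        - Poly_Mapping.single (x', y) 1 | x x' y. True}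
   \<union> {Poly_Mapping.single (x, y + y') 1 - Poly_Mapping.single (x, y) 1
        - Poly_Mapping.single (x, y') 1 | x y y'. True}
   \<union> {Poly_Mapping.single (c *\<^sub>C x, y) 1 - Poly_Mapping.single (x, y) c | c x y. True}
   \<union> {Poly_Mapping.single (x, c *\<^sub>C y) 1 - Poly_Mapping.single (x, y) c | c x y. True}"

definition tensor_equiv ::
  "('a::complex_vector \<times> 'b::complex_vector \<Rightarrow>\<^sub>0 complex) \<Rightarrow> ('a \<times> 'b \<Rightarrow>\<^sub>0 complex) \<Rightarrow> bool"
  where "tensor_equiv p q \<longleftrightarrow> p - q \<in> cvec.span tensor_relations"

lemma equivp_tensor_equiv:
  "equivp (tensor_equiv :: ('a::complex_vector \<times> 'b::complex_vector \<Rightarrow>\<^sub>0 complex) \<Rightarrow> _)"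
proof (rule equivpI)
  show "reflp (tensor_equiv :: ('a \<times> 'b \<Rightarrow>\<^sub>0 complex) \<Rightarrow> _)"
    by (auto intro!: reflpI simp: tensor_equiv_def cvec.span_zero)
  show "symp (tensor_equiv :: ('a \<times> 'b \<Rightarrow>\<^sub>0 complex) \<Rightarrow> _)"
  proof (rule sympI)
    fix p q :: "'a \<times> 'b \<Rightarrow>\<^sub>0 complex" assume "tensor_equiv p q"
    then have "- (p - q) \<in> cvec.span tensor_relations"
      unfolding tensor_equiv_def by (rule cvec.span_neg)
    then show "tensor_equiv q p" by (simp add: tensor_equiv_def)
  qed
  show "transp (tensor_equiv :: ('a \<times> 'b \<Rightarrow>\<^sub>0 complex) \<Rightarrow> _)"
  proof (rule transpI)
    fix p q r :: "'a \<times> 'b \<Rightarrow>\<^sub>0 complex" assume "tensor_equiv p q" "tensor_equiv q r"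
    then have "(p - q) + (q - r) \<in> cvec.span tensor_relations"
      unfolding tensor_equiv_def by (rule cvec.span_add)
    then show "tensor_equiv p r" by (simp add: tensor_equiv_def)
  qed
qed

quotient_type (overloaded) ('a, 'b) tensor (infixr "\<otimes>" 70) =
  "'a::complex_vector \<times> 'b::complex_vector \<Rightarrow>\<^sub>0 complex" / tensor_equiv
  by (rule equivp_tensor_equiv)

instantiation tensor :: (complex_vector, complex_vector) complex_vector
begin

lift_definition zero_tensor :: "'a \<otimes> 'b" is 0 .

lift_definition plus_tensor :: "'a \<otimes> 'b \<Rightarrow> 'a \<otimes> 'b \<Rightarrow> 'a \<otimes> 'b" is "(+)"
proof -
  fix p p' q q' :: "'a \<times> 'b \<Rightarrow>\<^sub>0 complex" assume "tensor_equiv p p'" "tensor_equiv q q'"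
  then have "(p - p') + (q - q') \<in> cvec.span tensor_relations"
    unfolding tensor_equiv_def by (rule cvec.span_add)
  then show "tensor_equiv (p + q) (p' + q')" by (simp add: tensor_equiv_def algebra_simps)
qed

lift_definition uminus_tensor :: "'a \<otimes> 'b \<Rightarrow> 'a \<otimes> 'b" is uminus
proof -
  fix p p' :: "'a \<times> 'b \<Rightarrow>\<^sub>0 complex" assume "tensor_equiv p p'"
  then have "- (p - p') \<in> cvec.span tensor_relations"
    unfolding tensor_equiv_def by (rule cvec.span_neg)
  then show "tensor_equiv (- p) (- p')" by (simp add: tensor_equiv_def algebra_simps)
qed

lift_definition minus_tensor :: "'a \<otimes> 'b \<Rightarrow> 'a \<otimes> 'b \<Rightarrow> 'a \<otimes> 'b" is "(-)"
proof -
  fix p p' q q' :: "'a \<times> 'b \<Rightarrow>\<^sub>0 complex" assume "tensor_equiv p p'" "tensor_equiv q q'"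
  then have "(p - p') - (q - q') \<in> cvec.span tensor_relations"
    unfolding tensor_equiv_def by (rule cvec.span_diff)
  then show "tensor_equiv (p - q) (p' - q')" by (simp add: tensor_equiv_def algebra_simps)
qed

lift_definition scaleC_tensor :: "complex \<Rightarrow> 'a \<otimes> 'b \<Rightarrow> 'a \<otimes> 'b" is scaleC
proof -
  fix c and p p' :: "'a \<times> 'b \<Rightarrow>\<^sub>0 complex" assume "tensor_equiv p p'"
  then have "c *\<^sub>C (p - p') \<in> cvec.span tensor_relations"
    unfolding tensor_equiv_def by (rule cvec.span_scale)
  then show "tensor_equiv (c *\<^sub>C p) (c *\<^sub>C p')"
    by (simp add: tensor_equiv_def cvec.scale_right_diff_distrib)
qed

instance
proof
  fix c d and x y z :: "'a \<otimes> 'b"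
  have *: "tensor_equiv p p" for p :: "'a \<times> 'b \<Rightarrow>\<^sub>0 complex"
    using equivp_reflp[OF equivp_tensor_equiv] .
  show "x + y + z = x + (y + z)" by transfer (simp add: add.assoc *)
  show "x + y = y + x" by transfer (simp add: add.commute *)
  show "0 + x = x" by transfer (simp add: *)
  show "- x + x = 0" by transfer (simp add: *)
  show "x - y = x + - y" by transfer (simp add: *)
  show "c *\<^sub>C (x + y) = c *\<^sub>C x + c *\<^sub>C y" by transfer (simp add: scaleC_add_right *)
  show "(c + d) *\<^sub>C x = c *\<^sub>C x + d *\<^sub>C x" by transfer (simp add: scaleC_add_left *)
  show "c *\<^sub>C d *\<^sub>C x = (c * d) *\<^sub>C x" by transfer (simp add: *)
  show "1 *\<^sub>C x = x" by transfer (simp add: *)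
qed

end

lift_definition pure_tensor :: "'a::complex_vector \<Rightarrow> 'b::complex_vector \<Rightarrow> 'a \<otimes> 'b" (infixr "\<otimes>" 75)
  is "\<lambda>x y. Poly_Mapping.single (x, y) 1" .

lemma cbilinear_pure_tensor: "cbilinear (\<otimes>)"
proof (rule cbilinearI; transfer)
  have scale: "c *\<^sub>C Poly_Mapping.single k (1::complex) = Poly_Mapping.single k c"
    for c and k :: "'a \<times> 'b"
    by (auto intro!: poly_mapping_eqI simp: lookup_scaleC lookup_single when_def)
  fix x x' :: 'a and y y' :: 'b and c
  let ?s = "Poly_Mapping.single :: 'a \<times> 'b \<Rightarrow> complex \<Rightarrow> _"
  show "tensor_equiv (?s (x, y + y') 1) (?s (x, y) 1 + ?s (x, y') 1)"
    unfolding tensor_equiv_def diff_diff_eq[symmetric]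
    by (rule cvec.span_base) (unfold tensor_relations_def, blast)
  show "tensor_equiv (?s (x + x', y) 1) (?s (x, y) 1 + ?s (x', y) 1)"
    unfolding tensor_equiv_def diff_diff_eq[symmetric]
    by (rule cvec.span_base) (unfold tensor_relations_def, blast)
  show "tensor_equiv (?s (x, c *\<^sub>C y) 1) (c *\<^sub>C ?s (x, y) 1)"
    unfolding tensor_equiv_def scale
    by (rule cvec.span_base) (unfold tensor_relations_def, blast)
  show "tensor_equiv (?s (c *\<^sub>C x, y) 1) (c *\<^sub>C ?s (x, y) 1)"
    unfolding tensor_equiv_def scale
    by (rule cvec.span_base) (unfold tensor_relations_def, blast)
qed

lemmas pure_tensor_simps = cbilinearD[OF cbilinear_pure_tensor]

lemma tensor_induct [case_names pure add]:
  fixes t :: "'a::complex_vector \<otimes> 'b::complex_vector"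
  assumes pure: "\<And>x y. P (x \<otimes> y)" and add: "\<And>s t. P s \<Longrightarrow> P t \<Longrightarrow> P (s + t)"
  shows "P t"
proof -
  have *: "abs_tensor (Poly_Mapping.single (x, y) c) = (c *\<^sub>C x) \<otimes> y" for c and x :: 'a and y :: 'b
  proof -
    have "c *\<^sub>C Poly_Mapping.single (x, y) (1::complex) = Poly_Mapping.single (x, y) c"
      by (auto intro!: poly_mapping_eqI simp: lookup_scaleC lookup_single when_def)
    then show ?thesis
      by (metis pure_tensor.abs_eq pure_tensor_simps(4) scaleC_tensor.abs_eq)
  qed
  have "P (abs_tensor p)" for p
  proof (induction p rule: update_induct)
    case const
    have "abs_tensor 0 = (0::'a) \<otimes> (0::'b)"
      using *[of 0 0 0] by simp
    then show ?case using pure by metis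
  next
    case (update p k c)
    obtain x y where k: "k = (x, y)" by (cases k)
    have "Poly_Mapping.update k c p = Poly_Mapping.single k c + p"
      using update by (auto intro!: poly_mapping_eqI
          simp: lookup_update lookup_add lookup_single when_def in_keys_iff)
    then have "abs_tensor (Poly_Mapping.update k c p) = (c *\<^sub>C x) \<otimes> y + abs_tensor p"
      by (simp add: plus_tensor.abs_eq[symmetric] * k)
    then show ?case using add pure update by metis
  qed
  then show ?thesis by (metis Quotient3_abs_rep Quotient3_tensor)
qed

lemma clinear_tensor_eqI:
  assumes "clinear f" "clinear g" "\<And>x y. f (x \<otimes> y) = g (x \<otimes> y)"
  shows "f t = g t"
  by (induction t rule: tensor_induct) (auto simp: assms clinear_add)

text \<open>The linear map induced by a bilinear map, by the universal property.\<close>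

definition tensor_lift ::
  "('a::complex_vector \<Rightarrow> 'b::complex_vector \<Rightarrow> 'c::complex_vector) \<Rightarrow> 'a \<otimes> 'b \<Rightarrow> 'c"
  where "tensor_lift f = (THE g. clinear g \<and> (\<forall>x y. g (x \<otimes> y) = f x y))"

lemma tensor_lift_ex:
  assumes f: "cbilinear f"
  shows "\<exists>!g. clinear g \<and> (\<forall>x y. g (x \<otimes> y) = f x y)"
proof -
  define F where "F p = (\<Sum>k\<in>Poly_Mapping.keys p. poly_mapping.lookup p k *\<^sub>C f (fst k) (snd k))" for p
  have F_sup: "F p = (\<Sum>k\<in>S. poly_mapping.lookup p k *\<^sub>C f (fst k) (snd k))"
    if "finite S" "Poly_Mapping.keys p \<subseteq> S" for p S
    unfolding F_def using that by (intro sum.mono_neutral_left) (auto simp: in_keys_iff)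
  have F_add: "F (p + q) = F p + F q" for p q
    using keys_add[of p q]
    by (simp add: F_sup[of "Poly_Mapping.keys p \<union> Poly_Mapping.keys q"] lookup_add scaleC_add_left sum.distrib)
  have F_scale: "F (c *\<^sub>C p) = c *\<^sub>C F p" for c p
    using F_sup[of "Poly_Mapping.keys p" "c *\<^sub>C p"]
    by (force simp: F_def lookup_scaleC scaleC_scaleC cvec.scale_sum_right in_keys_iff)
  have F_lin: "clinear F" by (rule clinearI) (auto simp: F_add F_scale)
  have F_single: "F (Poly_Mapping.single (x, y) c) = c *\<^sub>C f x y" for x y c
    by (simp add: F_def)
  have rel: "F p = 0" if "p \<in> cvec.span tensor_relations" for p
    using that
  proof (rule cvec_pair.linear_eq_0_on_span[OF F_lin, rotated])
    fix p :: "'a \<times> 'b \<Rightarrow>\<^sub>0 complex" assume "p \<in> tensor_relations"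
    then show "F p = 0"
      unfolding tensor_relations_def
      by (auto simp: cvec_pair.linear_diff[OF F_lin] F_single scaleC_one cbilinearD[OF f])
  qed
  have resp: "F p = F q" if "tensor_equiv p q" for p q
    using rel[of "p - q"] that by (simp add: tensor_equiv_def cvec_pair.linear_diff[OF F_lin])
  define g where "g t = F (rep_tensor t)" for t
  have g_abs: "g (abs_tensor p) = F p" for p
    unfolding g_def by (rule resp) (rule Quotient3_rep_abs[OF Quotient3_tensor],
        rule equivp_reflp[OF equivp_tensor_equiv])
  have "clinear g"
  proof (rule clinearI)
    fix s t :: "'a \<otimes> 'b" and c
    obtain p q where "s = abs_tensor p" "t = abs_tensor q"
      by (metis Quotient3_abs_rep Quotient3_tensor)
    then show "g (s + t) = g s + g t" "g (c *\<^sub>C s) = c *\<^sub>C g s"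
      by (simp_all add: plus_tensor.abs_eq scaleC_tensor.abs_eq g_abs F_add F_scale)
  qed
  moreover have "g (x \<otimes> y) = f x y" for x y
    by (simp add: pure_tensor.abs_eq g_abs F_single scaleC_one)
  moreover have "g' = g" if "clinear g'" "\<forall>x y. g' (x \<otimes> y) = f x y" for g'
    by (rule ext, rule clinear_tensor_eqI) (use that calculation in auto)
  ultimately show ?thesis by blast
qed

lemma
  assumes "cbilinear f"
  shows clinear_tensor_lift: "clinear (tensor_lift f)"
    and tensor_lift_pure: "tensor_lift f (x \<otimes> y) = f x y"
proof -
  have *: "clinear (tensor_lift f) \<and> (\<forall>x y. tensor_lift f (x \<otimes> y) = f x y)"
    unfolding tensor_lift_def by (rule theI'[OF tensor_lift_ex[OF assms]])
  show "clinear (tensor_lift f)" by (rule conjunct1[OF *])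
  show "tensor_lift f (x \<otimes> y) = f x y" using conjunct2[OF *] by blast
qed

lemma tensor_lift_combine:
  assumes f: "\<And>x. cbilinear (f x)"
    and "\<And>x x' y z. f (x + x') y z = f x y z + f x' y z"
    and "\<And>c x y z. f (c *\<^sub>C x) y z = c *\<^sub>C f x y z"
  shows "clinear (\<lambda>x. tensor_lift (f x) t)"
proof -
  note lin = clinear_tensor_lift[OF f]
  have add: "tensor_lift (f (x + x')) t = tensor_lift (f x) t + tensor_lift (f x') t" for x x'
  proof (induction t rule: tensor_induct)
    case (pure y z)
    show ?case unfolding tensor_lift_pure[OF f] by (rule assms)
  next
    case (add s t)
    then show ?case unfolding clinear_add[OF lin] by simp
  qed
  have scale: "tensor_lift (f (c *\<^sub>C x)) t = c *\<^sub>C tensor_lift (f x) t" for c x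
  proof (induction t rule: tensor_induct)
    case (pure y z)
    show ?case unfolding tensor_lift_pure[OF f] by (rule assms)
  next
    case (add s t)
    then show ?case unfolding clinear_add[OF lin] by (simp add: scaleC_add_right)
  qed
  show ?thesis by (rule clinearI) (fact add scale)+
qed

definition tensor_map ::
  "('a::complex_vector \<Rightarrow> 'c::complex_vector) \<Rightarrow> ('b::complex_vector \<Rightarrow> 'd::complex_vector)
    \<Rightarrow> 'a \<otimes> 'b \<Rightarrow> 'c \<otimes> 'd"
  where "tensor_map f g = tensor_lift (\<lambda>x y. f x \<otimes> g y)"

definition tensor_flip :: "'a::complex_vector \<otimes> 'b::complex_vector \<Rightarrow> 'b \<otimes> 'a"
  where "tensor_flip = tensor_lift (\<lambda>x y. y \<otimes> x)"

definition tensor_assoc ::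
  "('a::complex_vector \<otimes> 'b::complex_vector) \<otimes> 'c::complex_vector \<Rightarrow> 'a \<otimes> 'b \<otimes> 'c"
  where "tensor_assoc = tensor_lift (\<lambda>t z. tensor_lift (\<lambda>x y. x \<otimes> y \<otimes> z) t)"

instantiation tensor :: (complex_algebra, complex_algebra) complex_algebra
begin

definition times_tensor :: "'a \<otimes> 'b \<Rightarrow> 'a \<otimes> 'b \<Rightarrow> 'a \<otimes> 'b"
  where "s * t = tensor_lift (\<lambda>x y. tensor_lift (\<lambda>x' y'. (x * x') \<otimes> (y * y')) t) s"

lemma cbilinear_times_tensor: "cbilinear ((*) :: 'a \<otimes> 'b \<Rightarrow> _)"
  and times_tensor_pure: "(x \<otimes> y) * (x' \<otimes> y') = (x * x') \<otimes> (y * y')" for x x' :: 'a and y y' :: 'b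
proof -
  note ring = mult_scaleC_left mult_scaleC_right distrib_left distrib_right pure_tensor_simps
  have 1: "cbilinear (\<lambda>x' y'. (x * x') \<otimes> (y * y'))" for x :: 'a and y :: 'b
    by (rule cbilinearI) (simp_all add: ring)
  have 2: "cbilinear (\<lambda>x y. tensor_lift (\<lambda>x' y'. (x * x') \<otimes> (y * y')) t)" for t :: "'a \<otimes> 'b"
    unfolding cbilinear_def
    by (intro conjI allI tensor_lift_combine 1) (simp_all add: ring)
  have 3: "clinear (\<lambda>s. s * t)" for t :: "'a \<otimes> 'b"
    unfolding times_tensor_def by (rule clinear_tensor_lift[OF 2])
  have 4: "(x \<otimes> y) * t = tensor_lift (\<lambda>x' y'. (x * x') \<otimes> (y * y')) t" for x y and t :: "'a \<otimes> 'b"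
    unfolding times_tensor_def by (rule tensor_lift_pure[OF 2])
  have "s * (t + t') = s * t + s * t'" and "s * (c *\<^sub>C t) = c *\<^sub>C (s * t)" for s t t' :: "'a \<otimes> 'b" and c
    by (induction s rule: tensor_induct)
      (simp_all add: 4 clinear_add[OF clinear_tensor_lift[OF 1]]
        clinear_scaleC[OF clinear_tensor_lift[OF 1]] clinear_add[OF 3] scaleC_add_right add_ac)
  then show "cbilinear ((*) :: 'a \<otimes> 'b \<Rightarrow> _)"
    by (intro cbilinearI) (simp_all add: clinear_add[OF 3] clinear_scaleC[OF 3])
  show "(x \<otimes> y) * (x' \<otimes> y') = (x * x') \<otimes> (y * y')" for x x' :: 'a and y y' :: 'b
    by (simp add: 4 tensor_lift_pure[OF 1])
qed

instance
proof
  fix c and s t u :: "'a \<otimes> 'b"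
  note bil = cbilinearD[OF cbilinear_times_tensor]
  show "(s + t) * u = s * u + t * u" "s * (t + u) = s * t + s * u"
    "(c *\<^sub>C s) * t = c *\<^sub>C (s * t)" "s * (c *\<^sub>C t) = c *\<^sub>C (s * t)"
    by (rule bil)+
  show "s * t * u = s * (t * u)"
  proof (induction s rule: tensor_induct)
    case (pure x y)
    show ?case
    proof (induction t rule: tensor_induct)
      case (pure x' y')
      show ?case
        by (induction u rule: tensor_induct) (simp_all add: times_tensor_pure mult.assoc bil)
    qed (simp add: bil)
  qed (simp add: bil)
qed

end

instantiation tensor :: (complex_unital_algebra, complex_unital_algebra) complex_unital_algebra
begin

definition one_tensor :: "'a \<otimes> 'b" where "one_tensor = 1 \<otimes> 1"

instance
proof
  fix t :: "'a \<otimes> 'b"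
  show "1 * t = t" "t * 1 = t"
    by (induction t rule: tensor_induct)
      (simp_all add: one_tensor_def times_tensor_pure distrib_left distrib_right)
qed

end

text \<open>The embeddings of \<open>H \<otimes> H\<close> in \<open>H \<otimes> H \<otimes> H\<close> (associated to the right).\<close>

definition leg12 :: "'h \<otimes> 'h \<Rightarrow> 'h \<otimes> 'h \<otimes> 'h::complex_unital_algebra"
  where "leg12 = tensor_map id (\<lambda>y. y \<otimes> 1)"

definition leg13 :: "'h \<otimes> 'h \<Rightarrow> 'h \<otimes> 'h \<otimes> 'h::complex_unital_algebra"
  where "leg13 = tensor_map id (\<lambda>y. 1 \<otimes> y)"

definition leg23 :: "'h \<otimes> 'h \<Rightarrow> 'h \<otimes> 'h \<otimes> 'h::complex_unital_algebra"
  where "leg23 t = 1 \<otimes> t"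

locale bialgebra =
  fixes \<Delta> :: "'h::complex_unital_algebra \<Rightarrow> 'h \<otimes> 'h" and \<epsilon> :: "'h \<Rightarrow> complex"
  assumes comult_linear: "clinear \<Delta>"
    and comult_mult: "\<Delta> (x * y) = \<Delta> x * \<Delta> y"
    and comult_one: "\<Delta> 1 = 1"
    and counit_linear: "clinear \<epsilon>"
    and counit_mult: "\<epsilon> (x * y) = \<epsilon> x * \<epsilon> y"
    and counit_one: "\<epsilon> 1 = 1"
    and coassoc: "tensor_assoc (tensor_map \<Delta> id (\<Delta> x)) = tensor_map id \<Delta> (\<Delta> x)"
    and counit_left: "tensor_lift (\<lambda>u v. \<epsilon> u *\<^sub>C v) (\<Delta> x) = x"
    and counit_right: "tensor_lift (\<lambda>u v. \<epsilon> v *\<^sub>C u) (\<Delta> x) = x"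

locale quasitriangular_bialgebra = bialgebra \<Delta> \<epsilon>
  for \<Delta> :: "'h::complex_unital_algebra \<Rightarrow> 'h \<otimes> 'h" and \<epsilon> +
  fixes R :: "'h \<otimes> 'h"
  assumes R_invertible: "cinvertible R"
    and comult_R_left: "tensor_assoc (tensor_map \<Delta> id R) = leg13 R * leg23 R"
    and comult_R_right: "tensor_map id \<Delta> R = leg13 R * leg12 R"
    and R_comult: "R * \<Delta> h = tensor_flip (\<Delta> h) * R"

locale quasitriangular_bialgebra_with_involution = quasitriangular_bialgebra \<Delta> \<epsilon> R
  for \<Delta> :: "'h::complex_unital_algebra \<Rightarrow> 'h \<otimes> 'h" and \<epsilon> R +
  fixes \<tau> :: "'h \<Rightarrow> 'h"
  assumes invol_linear: "clinear \<tau>"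
    and invol_invol: "\<tau> (\<tau> x) = x"
    and invol_comult: "\<Delta> (\<tau> x) = tensor_map \<tau> \<tau> (\<Delta> x)"
    and invol_counit: "\<epsilon> (\<tau> x) = \<epsilon> x"
    and invol_mult: "\<tau> (x * y) = \<tau> y * \<tau> x"
    and invol_one: "\<tau> 1 = 1"

text \<open>The relation \<open>\<Sum> \<Delta>(s\<^sub>i) \<otimes> a\<^sub>i = \<Sum> s\<^sub>i \<tau>(R\<^sub>1) \<otimes> R\<^sub>2 s\<^sub>j \<otimes> a\<^sub>i a\<^sub>j\<close> in \<open>(H \<otimes> H) \<otimes> A\<close>,
  written out so that \<open>A\<close> need not have a unit.\<close>

definition universal_S_matrix ::
  "('h::complex_unital_algebra \<Rightarrow> 'h \<otimes> 'h) \<Rightarrow> 'h \<otimes> 'h \<Rightarrow> ('h \<Rightarrow> 'h)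
    \<Rightarrow> 'h \<otimes> 'a::complex_algebra \<Rightarrow> bool"
  where "universal_S_matrix \<Delta> R \<tau> S \<longleftrightarrow> S \<noteq> 0 \<and>
    tensor_map \<Delta> id S =
      tensor_lift (\<lambda>s a. tensor_lift (\<lambda>r\<^sub>1 r\<^sub>2. tensor_lift (\<lambda>s' a'.
        ((s * \<tau> r\<^sub>1) \<otimes> (r\<^sub>2 * s')) \<otimes> (a * a')) S) R) S"

typedef (overloaded) 'h dual = "{f :: 'h::complex_vector \<Rightarrow> complex. clinear f}"
  morphisms pairing Dual
  by (rule exI[of _ "\<lambda>_. 0"]) (auto intro!: clinearI)

setup_lifting type_definition_dual

instantiation dual :: (complex_vector) complex_vector
begin

lift_definition zero_dual :: "'a dual" is "\<lambda>_. 0"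
  by (auto intro!: clinearI)

lift_definition plus_dual :: "'a dual \<Rightarrow> 'a dual \<Rightarrow> 'a dual" is "\<lambda>f g x. f x + g x"
  by (auto intro!: clinearI simp: clinear_add clinear_scaleC distrib_left)

lift_definition uminus_dual :: "'a dual \<Rightarrow> 'a dual" is "\<lambda>f x. - f x"
  by (auto intro!: clinearI simp: clinear_add clinear_scaleC)

lift_definition minus_dual :: "'a dual \<Rightarrow> 'a dual \<Rightarrow> 'a dual" is "\<lambda>f g x. f x - g x"
  by (auto intro!: clinearI simp: clinear_add clinear_scaleC right_diff_distrib)

lift_definition scaleC_dual :: "complex \<Rightarrow> 'a dual \<Rightarrow> 'a dual" is "\<lambda>c f x. c * f x"
  by (auto intro!: clinearI simp: clinear_add clinear_scaleC algebra_simps)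

instance
  by standard (transfer; simp add: fun_eq_iff algebra_simps)+

end

lift_definition left_action :: "'h::complex_unital_algebra \<Rightarrow> 'h dual \<Rightarrow> 'h dual" (infixr "\<triangleright>" 80)
  is "\<lambda>h a x. a (x * h)"
  by (auto intro!: clinearI simp: clinear_add clinear_scaleC distrib_right mult_scaleC_left)

lift_definition right_action :: "'h::complex_unital_algebra dual \<Rightarrow> 'h \<Rightarrow> 'h dual" (infixl "\<triangleleft>" 80)
  is "\<lambda>a h x. a (h * x)"
  by (auto intro!: clinearI simp: clinear_add clinear_scaleC distrib_left mult_scaleC_right)

definition dual_mult ::
  "('h::complex_unital_algebra \<Rightarrow> 'h \<otimes> 'h) \<Rightarrow> 'h dual \<Rightarrow> 'h dual \<Rightarrow> 'h dual"
  where "dual_mult \<Delta> a b = Dual (\<lambda>x. tensor_lift (\<lambda>u v. pairing a u * pairing b v) (\<Delta> x))"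

lemma clinear_pairing: "clinear (pairing a)"
  using pairing by auto

lemma pairing_dual_mult:
  assumes "clinear \<Delta>"
  shows "pairing (dual_mult \<Delta> a b) x = tensor_lift (\<lambda>u v. pairing a u * pairing b v) (\<Delta> x)"
proof -
  have "cbilinear (\<lambda>u v. pairing a u * pairing b v)"
    by (rule cbilinearI) (simp_all add: clinear_add[OF clinear_pairing]
        clinear_scaleC[OF clinear_pairing] algebra_simps)
  note lin = clinear_tensor_lift[OF this]
  have "clinear (\<lambda>x. tensor_lift (\<lambda>u v. pairing a u * pairing b v) (\<Delta> x))"
    by (rule clinearI)
      (simp_all add: clinear_add[OF assms] clinear_scaleC[OF assms] clinear_add[OF lin] clinear_scaleC[OF lin])
  then show ?thesis by (simp add: dual_mult_def Dual_inverse)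
qed

text \<open>The RE dual is the vector space \<^typ>\<open>'h dual\<close> with \<open>re_mult\<close> as product; the bilinear map
  under \<open>tensor_lift\<close> is contracted with the two factors of the inverse of \<open>R\<close>.\<close>

definition re_mult ::
  "('h::complex_unital_algebra \<Rightarrow> 'h \<otimes> 'h) \<Rightarrow> 'h \<otimes> 'h \<Rightarrow> ('h \<Rightarrow> 'h)
    \<Rightarrow> 'h dual \<Rightarrow> 'h dual \<Rightarrow> 'h dual"
  where "re_mult \<Delta> R \<tau> a b =
    tensor_lift (\<lambda>r\<^sub>1 r\<^sub>2. dual_mult \<Delta> (\<tau> r\<^sub>1 \<triangleright> a) (b \<triangleleft> r\<^sub>2)) (cinverse R)"

text \<open>The dual basis of a basis \<open>B\<close>: \<open>coordinate B e\<close> is the coefficient of \<open>e \<in> B\<close>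
  in the expansion of a vector with respect to \<open>B\<close>.\<close>

lift_definition coordinate :: "'h::complex_vector set \<Rightarrow> 'h \<Rightarrow> 'h dual"
  is "\<lambda>B e. if cbasis B then (\<lambda>v. cvec.representation B v e) else (\<lambda>_. 0)"
  by (auto intro!: clinearI simp: cbasis_def cvec.representation_add cvec.representation_scale)

definition canonical_element :: "'h::complex_vector set \<Rightarrow> 'h \<otimes> 'h dual"
  where "canonical_element B = (\<Sum>e\<in>B. e \<otimes> coordinate B e)"

end

theory Submission
  imports Defs
begin

text \<open>The map is \<open>\<phi>(a) = \<Sum> \<langle>a, s\<^sub>i\<rangle> a\<^sub>i\<close>, the contraction of \<open>S\<^sub>A\<close> with \<open>a\<close>; it is the only linear
  map with \<open>S\<^sub>A = (id \<otimes> \<phi>)(S)\<close> because \<open>a = \<Sum> \<langle>a, e\<^sub>\<mu>\<rangle> e\<^sup>\<mu>\<close>.  The S-matrix relation turns the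
  contraction of \<open>S\<^sub>A\<close> with \<open>m(a \<otimes> b)\<close> into
  \<open>\<phi>(\<tau>(R\<^sub>1) \<triangleright> a) \<phi>(b \<triangleleft> R\<^sub>2)\<close>.  Since \<open>\<tau>\<close> is an anti-automorphism, twisting \<open>m\<close> by the inverse
  of \<open>R\<close> cancels \<open>R\<close>.\<close>

section \<open>Linearity of maps induced on tensor products\<close>

lemma cbilinear_imp_clinear_left: "cbilinear f \<Longrightarrow> clinear (\<lambda>x. f x y)"
  and cbilinear_imp_clinear_right: "cbilinear f \<Longrightarrow> clinear (f x)"
  by (simp_all add: cbilinear_def)

lemma clinear_tensor_lift_parameter:
  assumes "\<And>x. cbilinear (f x)" "\<And>y z. clinear (\<lambda>x. f x y z)"
  shows "clinear (\<lambda>x. tensor_lift (f x) t)"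
  by (rule tensor_lift_combine)
    (simp_all add: assms(1) clinear_add[OF assms(2)] clinear_scaleC[OF assms(2)])

text \<open>Both sides are linear in \<open>t\<close> and agree on pure tensors. This moves a
  contraction under the sum over the legs of \<open>R\<close> or of its inverse.\<close>

lemma clinear_tensor_lift_commute:
  assumes L: "clinear L" and f: "cbilinear f"
  shows "L (tensor_lift f t) = tensor_lift (\<lambda>x y. L (f x y)) t"
proof -
  have Lf: "cbilinear (\<lambda>x y. L (f x y))"
    by (rule cbilinearI)
      (simp_all add: cbilinearD[OF f] clinear_add[OF L] clinear_scaleC[OF L])
  show ?thesis
    by (induction t rule: tensor_induct)
      (simp_all add: tensor_lift_pure[OF f] tensor_lift_pure[OF Lf]
        clinear_add[OF clinear_tensor_lift[OF f]] clinear_add[OF clinear_tensor_lift[OF Lf]]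
        clinear_add[OF L])
qed

text \<open>The product of a tensor product is taken leg by leg, so a double sum over two tensors
  whose legs are multiplied in matching order is one sum over their product. It makes the inverse of
  \<open>R\<close> meet \<open>R\<close>.\<close>

lemma tensor_lift_mult:
  fixes G :: "'a::complex_algebra \<Rightarrow> 'b::complex_algebra \<Rightarrow> 'c::complex_vector"
  assumes G: "cbilinear G"
  shows "tensor_lift (\<lambda>r r'. tensor_lift (\<lambda>q q'. G (r * q) (r' * q')) t) s = tensor_lift G (s * t)"
proof -
  note ring = mult_scaleC_left mult_scaleC_right distrib_left distrib_right cbilinearD[OF G]
  have 1: "cbilinear (\<lambda>q q'. G (r * q) (r' * q'))" for r r'
    by (rule cbilinearI) (simp_all add: ring)
  have 2: "cbilinear (\<lambda>r r'. tensor_lift (\<lambda>q q'. G (r * q) (r' * q')) u)" for u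
    unfolding cbilinear_def by (intro conjI allI tensor_lift_combine 1) (simp_all add: ring)
  note lin = clinear_add[OF clinear_tensor_lift]
  have 3: "tensor_lift (\<lambda>q q'. G (r * q) (r' * q')) t = tensor_lift G ((r \<otimes> r') * t)" for r r'
    by (induction t rule: tensor_induct)
      (simp_all add: tensor_lift_pure[OF 1] tensor_lift_pure[OF G] times_tensor_pure
        lin[OF 1] lin[OF G] distrib_left)
  \<comment> \<open>Rewriting \<open>2\<close> by \<open>3\<close> gives bilinearity of the
    integrand in the form that the goal has once \<open>3\<close> has simplified it.\<close>
  show ?thesis
    by (induction s rule: tensor_induct)
      (simp_all add: 3 tensor_lift_pure[OF 2[of t, unfolded 3]] lin[OF 2[of t, unfolded 3]]
        lin[OF G] distrib_right)
qed

section \<open>The dual space: bimodule structure and product\<close>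

lemma cbilinear_pairing: "cbilinear pairing"
  by (rule cbilinearI)
    (simp_all add: clinear_add[OF clinear_pairing] clinear_scaleC[OF clinear_pairing]
      plus_dual.rep_eq scaleC_dual.rep_eq)

lemma dual_eqI: "(\<And>x. pairing a x = pairing b x) \<Longrightarrow> a = b"
  by (simp add: pairing_inject[symmetric] fun_eq_iff)

lemma cbilinear_left_action: "cbilinear (\<triangleright>)"
  by (rule cbilinearI; rule dual_eqI)
    (simp_all add: left_action.rep_eq plus_dual.rep_eq scaleC_dual.rep_eq
      distrib_left mult_scaleC_right cbilinearD[OF cbilinear_pairing])

lemma cbilinear_right_action: "cbilinear (\<triangleleft>)"
  by (rule cbilinearI; rule dual_eqI)
    (simp_all add: right_action.rep_eq plus_dual.rep_eq scaleC_dual.rep_eq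
      distrib_right mult_scaleC_left cbilinearD[OF cbilinear_pairing])

lemma left_action_mult: "x \<triangleright> y \<triangleright> a = (x * y) \<triangleright> a"
  by (rule dual_eqI) (simp add: left_action.rep_eq mult.assoc)

lemma right_action_mult: "a \<triangleleft> x \<triangleleft> y = a \<triangleleft> (x * y)"
  by (rule dual_eqI) (simp add: right_action.rep_eq mult.assoc)

lemma left_action_one: "1 \<triangleright> a = a"
  by (rule dual_eqI) (simp add: left_action.rep_eq)

lemma right_action_one: "a \<triangleleft> 1 = a"
  by (rule dual_eqI) (simp add: right_action.rep_eq)

lemma cbilinear_pairing_mult: "cbilinear (\<lambda>u v. pairing a u * pairing b v)"
  by (rule cbilinearI) (simp_all add: cbilinearD[OF cbilinear_pairing] algebra_simps)

lemma cbilinear_dual_mult: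
  assumes "clinear \<Delta>"
  shows "cbilinear (dual_mult \<Delta>)"
proof -
  have 1: "clinear (\<lambda>a. tensor_lift (\<lambda>u v. pairing a u * pairing b v) t)" for b t
    by (rule clinear_tensor_lift_parameter, rule cbilinear_pairing_mult, rule clinearI)
      (simp_all add: plus_dual.rep_eq scaleC_dual.rep_eq algebra_simps)
  have 2: "clinear (\<lambda>b. tensor_lift (\<lambda>u v. pairing a u * pairing b v) t)" for a t
    by (rule clinear_tensor_lift_parameter, rule cbilinear_pairing_mult, rule clinearI)
      (simp_all add: plus_dual.rep_eq scaleC_dual.rep_eq algebra_simps)
  note rep_eqs = plus_dual.rep_eq scaleC_dual.rep_eq scaleC_complex
  \<comment> \<open>The goals have sums and scalar multiples of functionals already evaluated under
    \<open>tensor_lift\<close>. The linearity facts match them only after the same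
    unfolding.\<close>
  note sums = clinear_add[OF 1, unfolded rep_eqs] clinear_add[OF 2, unfolded rep_eqs]
    clinear_scaleC[OF 1, unfolded rep_eqs] clinear_scaleC[OF 2, unfolded rep_eqs]
  show ?thesis
    by (intro cbilinearI dual_eqI) (simp_all only: pairing_dual_mult[OF assms] rep_eqs sums)
qed

section \<open>Contraction with functionals and its multiplicativity\<close>

definition contract :: "'h::complex_vector \<otimes> 'a::complex_vector \<Rightarrow> 'h dual \<Rightarrow> 'a"
  where "contract S a = tensor_lift (\<lambda>s x. pairing a s *\<^sub>C x) S"

lemma cbilinear_pairing_scaleC: "cbilinear (\<lambda>s x. pairing a s *\<^sub>C x)"
  by (rule cbilinearI)
    (simp_all add: cbilinearD[OF cbilinear_pairing] scaleC_add_left scaleC_add_right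
      scaleC_scaleC mult.commute)

lemma contract_pure: "contract (s \<otimes> x) a = pairing a s *\<^sub>C x"
  unfolding contract_def by (rule tensor_lift_pure[OF cbilinear_pairing_scaleC])

lemma cbilinear_contract:
  "cbilinear (contract :: 'h::complex_vector \<otimes> 'a::complex_vector \<Rightarrow> 'h dual \<Rightarrow> 'a)"
  unfolding cbilinear_def
proof (intro conjI allI)
  fix S :: "'h \<otimes> 'a"
  show "clinear (contract S)"
    unfolding contract_def
    by (rule clinear_tensor_lift_parameter, rule cbilinear_pairing_scaleC, rule clinearI)
      (simp_all add: cbilinearD[OF cbilinear_pairing] scaleC_add_left scaleC_scaleC)
next
  fix a :: "'h dual"
  show "clinear (\<lambda>S :: 'h \<otimes> 'a. contract S a)"
    unfolding contract_def by (rule clinear_tensor_lift[OF cbilinear_pairing_scaleC])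
qed

lemmas contract_simps = cbilinearD[OF cbilinear_contract]

lemma clinear_contract: "clinear (contract S)"
  by (rule cbilinear_imp_clinear_right[OF cbilinear_contract])

text \<open>The map a \<otimes> b \<otimes> id, bracketed to the left because
  \<open>tensor_map \<Delta> id\<close> takes its values there.\<close>

definition contract2 ::
  "'h::complex_vector dual \<Rightarrow> 'h dual \<Rightarrow> ('h \<otimes> 'h) \<otimes> 'a::complex_vector \<Rightarrow> 'a"
  where "contract2 a b =
    tensor_lift (\<lambda>t x. tensor_lift (\<lambda>u v. pairing a u * pairing b v) t *\<^sub>C x)"

lemma clinear_contract2: "clinear (contract2 a b)"
  and contract2_pure:
    "contract2 a b (t \<otimes> x) = tensor_lift (\<lambda>u v. pairing a u * pairing b v) t *\<^sub>C x"
proof -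
  note lin = clinear_tensor_lift[OF cbilinear_pairing_mult[of a b]]
  have *: "cbilinear (\<lambda>t x. tensor_lift (\<lambda>u v. pairing a u * pairing b v) t *\<^sub>C x)"
    by (rule cbilinearI)
      (simp_all add: clinear_add[OF lin] clinear_scaleC[OF lin] scaleC_add_left
        scaleC_add_right scaleC_scaleC mult.commute)
  show "clinear (contract2 a b)"
    unfolding contract2_def by (rule clinear_tensor_lift[OF *])
  show "contract2 a b (t \<otimes> x) = tensor_lift (\<lambda>u v. pairing a u * pairing b v) t *\<^sub>C x"
    unfolding contract2_def by (rule tensor_lift_pure[OF *])
qed

text \<open>The product of the dual algebra is the transpose of \<open>\<Delta>\<close>. By
  linearity in \<open>S\<close> it is enough to compare the scalars in front of \<open>x\<close> for
  a pure tensor \<open>s \<otimes> x\<close>.\<close>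

lemma contract_dual_mult:
  assumes \<Delta>: "clinear \<Delta>"
  shows "contract S (dual_mult \<Delta> a b) = contract2 a b (tensor_map \<Delta> id S)"
proof -
  have *: "cbilinear (\<lambda>x y. \<Delta> x \<otimes> y)"
    by (rule cbilinearI)
      (simp_all add: clinear_add[OF \<Delta>] clinear_scaleC[OF \<Delta>] pure_tensor_simps)
  show ?thesis
    unfolding tensor_map_def id_apply
    by (induction S rule: tensor_induct)
      (simp_all add: contract_pure tensor_lift_pure[OF *] contract2_pure pairing_dual_mult[OF \<Delta>]
        contract_simps clinear_add[OF clinear_tensor_lift[OF *]] clinear_add[OF clinear_contract2])
qed

text \<open>The actions are transposes of multiplication: evaluating \<open>a\<close> at
  \<open>s * \<tau> r\<^sub>1\<close> is evaluating
  \<open>\<tau> r\<^sub>1 \<triangleright> a\<close> at \<open>s\<close>, and evaluating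
  \<open>b\<close> at \<open>r\<^sub>2 * s'\<close> is evaluating
  \<open>b \<triangleleft> r\<^sub>2\<close> at \<open>s'\<close>. The legs of \<open>R\<close> thus
  pass to the functionals and the sum splits into a product of two contractions. Distinct
  \<open>S\<close> and \<open>S'\<close> allow separate inductions.\<close>

lemma contract2_S_product:
  fixes S S' :: "'h::complex_unital_algebra \<otimes> 'a::complex_algebra"
  assumes \<tau>: "clinear \<tau>"
  shows "contract2 a b
      (tensor_lift (\<lambda>s x. tensor_lift (\<lambda>r\<^sub>1 r\<^sub>2. tensor_lift (\<lambda>s' x'.
        ((s * \<tau> r\<^sub>1) \<otimes> (r\<^sub>2 * s')) \<otimes> (x * x')) S') R) S) =
    tensor_lift (\<lambda>r\<^sub>1 r\<^sub>2. contract S (\<tau> r\<^sub>1 \<triangleright> a) * contract S' (b \<triangleleft> r\<^sub>2)) R"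
proof -
  note ring = mult_scaleC_left mult_scaleC_right distrib_left distrib_right pure_tensor_simps
    clinear_add[OF \<tau>] clinear_scaleC[OF \<tau>] contract_simps
    cbilinearD[OF cbilinear_left_action] cbilinearD[OF cbilinear_right_action]
  let ?f = "\<lambda>s (x::'a) r\<^sub>1 (r\<^sub>2::'h) s' x'. ((s * \<tau> r\<^sub>1) \<otimes> (r\<^sub>2 * s')) \<otimes> (x * x')"
  have 1: "cbilinear (?f s x r\<^sub>1 r\<^sub>2)" for s x r\<^sub>1 r\<^sub>2
    by (rule cbilinearI) (simp_all add: ring)
  have 2: "cbilinear (\<lambda>r\<^sub>1 r\<^sub>2. tensor_lift (?f s x r\<^sub>1 r\<^sub>2) S')" for s x
    unfolding cbilinear_def by (intro conjI allI tensor_lift_combine 1) (simp_all add: ring)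
  have 3: "cbilinear (\<lambda>s x. tensor_lift (\<lambda>r\<^sub>1 r\<^sub>2. tensor_lift (?f s x r\<^sub>1 r\<^sub>2) S') R)"
    unfolding cbilinear_def
    by (intro conjI allI clinear_tensor_lift_parameter 1 2 clinearI) (simp_all add: ring)
  have 4: "cbilinear (\<lambda>r\<^sub>1 r\<^sub>2. contract S (\<tau> r\<^sub>1 \<triangleright> a) * contract S' (b \<triangleleft> r\<^sub>2))" for S
    by (rule cbilinearI) (simp_all add: ring)
  have inner: "contract2 a b (tensor_lift (?f s x r\<^sub>1 r\<^sub>2) S') =
      contract (s \<otimes> x) (\<tau> r\<^sub>1 \<triangleright> a) * contract S' (b \<triangleleft> r\<^sub>2)" for s x r\<^sub>1 r\<^sub>2
    by (induction S' rule: tensor_induct)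
      (simp_all add: tensor_lift_pure[OF 1] tensor_lift_pure[OF cbilinear_pairing_mult]
        contract2_pure contract_pure left_action.rep_eq right_action.rep_eq
        clinear_add[OF clinear_tensor_lift[OF 1]] clinear_add[OF clinear_contract2] ring
        scaleC_scaleC mult.commute)
  show ?thesis
  proof (induction S rule: tensor_induct)
    case (pure s x)
    show ?case
      unfolding tensor_lift_pure[OF 3] clinear_tensor_lift_commute[OF clinear_contract2 2] inner ..
  next
    case (add S T)
    have "clinear (\<lambda>S. tensor_lift (\<lambda>r\<^sub>1 r\<^sub>2. contract S (\<tau> r\<^sub>1 \<triangleright> a) * contract S' (b \<triangleleft> r\<^sub>2)) R)"
      by (intro clinear_tensor_lift_parameter 4 clinearI) (simp_all add: ring)
    from clinear_add[OF this, of S T] show ?case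
      by (simp add: clinear_add[OF clinear_tensor_lift[OF 3]] clinear_add[OF clinear_contract2] add)
  qed
qed

lemma contract_re_mult:
  assumes "quasitriangular_bialgebra_with_involution \<Delta> \<epsilon> R \<tau>"
    and S: "universal_S_matrix \<Delta> R \<tau> S"
  shows "contract S (re_mult \<Delta> R \<tau> a b) = contract S a * contract S b"
proof -
  interpret quasitriangular_bialgebra_with_involution \<Delta> \<epsilon> R \<tau> by fact
  note ring = mult_scaleC_left mult_scaleC_right distrib_left distrib_right
    clinear_add[OF invol_linear] clinear_scaleC[OF invol_linear] contract_simps
    cbilinearD[OF cbilinear_left_action] cbilinearD[OF cbilinear_right_action]
    cbilinearD[OF cbilinear_dual_mult[OF comult_linear]]
  let ?G = "\<lambda>r\<^sub>1 r\<^sub>2. contract S (\<tau> r\<^sub>1 \<triangleright> a) * contract S (b \<triangleleft> r\<^sub>2)"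
  have G: "cbilinear ?G" by (rule cbilinearI) (simp_all add: ring)
  have f: "cbilinear (\<lambda>r\<^sub>1 r\<^sub>2. dual_mult \<Delta> (\<tau> r\<^sub>1 \<triangleright> a) (b \<triangleleft> r\<^sub>2))"
    by (rule cbilinearI) (simp_all add: ring)
  have S_rel: "tensor_map \<Delta> id S = tensor_lift (\<lambda>s x. tensor_lift (\<lambda>r\<^sub>1 r\<^sub>2. tensor_lift (\<lambda>s' x'.
        ((s * \<tau> r\<^sub>1) \<otimes> (r\<^sub>2 * s')) \<otimes> (x * x')) S) R) S"
    using S by (simp add: universal_S_matrix_def)
  have "contract S (re_mult \<Delta> R \<tau> a b) =
      tensor_lift (\<lambda>r\<^sub>1 r\<^sub>2. contract S (dual_mult \<Delta> (\<tau> r\<^sub>1 \<triangleright> a) (b \<triangleleft> r\<^sub>2))) (cinverse R)"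
    unfolding re_mult_def by (rule clinear_tensor_lift_commute[OF clinear_contract f])
  \<comment> \<open>Let q run over \<open>R\<close> and r over its inverse. The functionals are
    acted on by \<open>\<tau> q\<^sub>1 * \<tau> r\<^sub>1\<close>, which is
    \<open>\<tau> (r\<^sub>1 * q\<^sub>1)\<close> by anti-multiplicativity, and by
    \<open>r\<^sub>2 * q\<^sub>2\<close>. Both legs now have the order of
    \<open>cinverse R * R\<close>, which is 1.\<close>
  also have "\<dots> =
      tensor_lift (\<lambda>r\<^sub>1 r\<^sub>2. tensor_lift (\<lambda>q\<^sub>1 q\<^sub>2. ?G (r\<^sub>1 * q\<^sub>1) (r\<^sub>2 * q\<^sub>2)) R) (cinverse R)"
    unfolding contract_dual_mult[OF comult_linear] S_rel contract2_S_product[OF invol_linear]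
    by (simp add: left_action_mult right_action_mult invol_mult)
  also have "\<dots> = tensor_lift ?G (1 \<otimes> 1)"
    unfolding tensor_lift_mult[OF G] by (simp add: cinverse[OF R_invertible] one_tensor_def)
  also have "\<dots> = contract S a * contract S b"
    by (simp add: tensor_lift_pure[OF G] invol_one left_action_one right_action_one)
  finally show ?thesis .
qed

section \<open>Dual bases and the canonical element\<close>

lemma pairing_coordinate: "cbasis B \<Longrightarrow> pairing (coordinate B e) v = cvec.representation B v e"
  by (simp add: coordinate.rep_eq)

lemma sum_coordinate:
  assumes "finite B" "cbasis B"
  shows "(\<Sum>e\<in>B. pairing (coordinate B e) v *\<^sub>C e) = v"
  using assms cvec.sum_representation_eq[of B v B] by (simp add: pairing_coordinate cbasis_def)

lemma pairing_sum: "pairing (\<Sum>e\<in>B. f e) v = (\<Sum>e\<in>B. pairing (f e) v)"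
  by (induction B rule: infinite_finite_induct) (simp_all add: zero_dual.rep_eq plus_dual.rep_eq)

text \<open>Apply \<open>a\<close> to the expansion of an arbitrary vector \<open>v\<close> in
  \<open>B\<close>.\<close>

lemma dual_expansion:
  assumes "finite B" "cbasis B"
  shows "(\<Sum>e\<in>B. pairing a e *\<^sub>C coordinate B e) = a"
proof (rule dual_eqI)
  fix v
  have "pairing a v = pairing a (\<Sum>e\<in>B. pairing (coordinate B e) v *\<^sub>C e)"
    by (simp add: sum_coordinate[OF assms])
  then show "pairing (\<Sum>e\<in>B. pairing a e *\<^sub>C coordinate B e) v = pairing a v"
    by (simp add: pairing_sum scaleC_dual.rep_eq mult.commute
        cvec_pair.linear_sum[OF clinear_pairing] clinear_scaleC[OF clinear_pairing])
qed

lemma tensor_map_canonical_element: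
  assumes "clinear \<phi>"
  shows "tensor_map id \<phi> (canonical_element B) = (\<Sum>e\<in>B. e \<otimes> \<phi> (coordinate B e))"
proof -
  have *: "cbilinear (\<lambda>x y. x \<otimes> \<phi> y)"
    by (rule cbilinearI)
      (simp_all add: clinear_add[OF assms] clinear_scaleC[OF assms] pure_tensor_simps)
  show ?thesis
    by (simp add: tensor_map_def canonical_element_def tensor_lift_pure[OF *]
        cvec_pair.linear_sum[OF clinear_tensor_lift[OF *]])
qed

text \<open>Existence half. For a pure tensor \<open>s \<otimes> x\<close> the coordinates of
  \<open>s\<close> appear as scalars on \<open>x\<close>; moved to the left factor they reassemble
  \<open>s\<close>.\<close>

lemma tensor_map_contract_canonical_element:
  assumes "finite B" "cbasis B"
  shows "tensor_map id (contract S) (canonical_element B) = S"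
  unfolding tensor_map_canonical_element[OF clinear_contract]
proof (induction S rule: tensor_induct)
  case (pure s x)
  have lin: "clinear (\<lambda>s. s \<otimes> x)"
    by (rule cbilinear_imp_clinear_left[OF cbilinear_pure_tensor])
  have "(\<Sum>e\<in>B. pairing (coordinate B e) s *\<^sub>C e) \<otimes> x = s \<otimes> x"
    by (simp add: sum_coordinate[OF assms])
  then show ?case
    by (simp add: contract_pure cvec_pair.linear_sum[OF lin] pure_tensor_simps)
next
  case (add S T)
  then show ?case by (simp add: contract_simps pure_tensor_simps sum.distrib)
qed

text \<open>Uniqueness half: with the preceding lemma, contraction is a two-sided inverse of sending
  a linear \<open>\<phi>\<close> to the image of the canonical element. The values of
  \<open>a\<close> on \<open>B\<close> are its coefficients in the dual basis.\<close>

lemma contract_tensor_map_canonical_element: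
  fixes B :: "'h::complex_vector set" and \<phi> :: "'h dual \<Rightarrow> 'a::complex_vector"
  assumes "finite B" "cbasis B" and \<phi>: "clinear \<phi>"
  shows "contract (tensor_map id \<phi> (canonical_element B)) = \<phi>"
proof
  fix a :: "'h dual"
  have lin: "clinear (\<lambda>S :: 'h \<otimes> 'a. contract S a)"
    by (rule cbilinear_imp_clinear_left[OF cbilinear_contract])
  have "contract (tensor_map id \<phi> (canonical_element B)) a =
      \<phi> (\<Sum>e\<in>B. pairing a e *\<^sub>C coordinate B e)"
    by (simp add: tensor_map_canonical_element[OF \<phi>] cvec_pair.linear_sum[OF lin] contract_pure
        cvec_pair.linear_sum[OF \<phi>] clinear_scaleC[OF \<phi>])
  then show "contract (tensor_map id \<phi> (canonical_element B)) a = \<phi> a"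
    by (simp add: dual_expansion[OF assms(1,2)])
qed

text \<open>Finite dimension is expressed by a finite basis. The quantifier over bases stands under
  the unique existence, so a single \<open>\<phi>\<close> serves all of them.\<close>

theorem proposition4:
  fixes \<Delta> :: "'h::complex_unital_algebra \<Rightarrow> 'h \<otimes> 'h"
    and \<epsilon> :: "'h \<Rightarrow> complex"
    and R :: "'h \<otimes> 'h"
    and \<tau> :: "'h \<Rightarrow> 'h"
    and S\<^sub>A :: "'h \<otimes> 'a::complex_algebra"
  assumes "\<exists>B :: 'h set. finite B \<and> cbasis B"
    and "quasitriangular_bialgebra_with_involution \<Delta> \<epsilon> R \<tau>"
    and "universal_S_matrix \<Delta> R \<tau> S\<^sub>A"
  shows "\<exists>!\<phi> :: 'h dual \<Rightarrow> 'a.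
    clinear \<phi> \<and>
    (\<forall>a b. \<phi> (re_mult \<Delta> R \<tau> a b) = \<phi> a * \<phi> b) \<and>
    (\<forall>B. cbasis B \<longrightarrow> S\<^sub>A = tensor_map id \<phi> (canonical_element B))"
proof -
  obtain B :: "'h set" where B: "finite B" "cbasis B" using assms(1) by blast
  \<comment> \<open>An independent set lying in the span of a finite set is finite. Over an infinite
    basis the sum in \<open>canonical_element\<close> would take the default value 0.\<close>
  have finite: "finite C" if "cbasis C" for C :: "'h set"
    using cvec.independent_span_bound[of B C] B that by (auto simp: cbasis_def)
  show ?thesis
  proof (intro ex1I[of _ "contract S\<^sub>A"] conjI allI impI)
    show "clinear (contract S\<^sub>A)" by (rule clinear_contract)
    show "contract S\<^sub>A (re_mult \<Delta> R \<tau> a b) = contract S\<^sub>A a * contract S\<^sub>A b" for a b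
      by (rule contract_re_mult) fact+
    show "S\<^sub>A = tensor_map id (contract S\<^sub>A) (canonical_element C)" if "cbasis C" for C
      by (rule tensor_map_contract_canonical_element[symmetric]) (fact finite[OF that] that)+
  next
    fix \<phi> :: "'h dual \<Rightarrow> 'a"
    assume "clinear \<phi> \<and>
      (\<forall>a b. \<phi> (re_mult \<Delta> R \<tau> a b) = \<phi> a * \<phi> b) \<and>
      (\<forall>B. cbasis B \<longrightarrow> S\<^sub>A = tensor_map id \<phi> (canonical_element B))"
    \<comment> \<open>The equation for the one basis \<open>B\<close> suffices: contracting its
      right-hand side gives back \<open>\<phi>\<close>.\<close>
    then show "\<phi> = contract S\<^sub>A"
      using contract_tensor_map_canonical_element[OF B, of \<phi>] B by metis
  qed
qed

end
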